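(* Let $g:D\to\mathbb{C}$ be a discrete holomorphic function with cross ratio factorizing function $\alpha$, let $\lambda$ be a freely chosen nonzero real parameter, and let $F$ be a solution of the discrete Bryant equation $$F_q-F_p=F_p\begin{pmatrix} g_p & -g_pg_q\\ 1 & -g_q\end{pmatrix}\frac{\lambda\alpha_{pq}}{g_q-g_p},\qquad \det F\in\mathbb{R},$$ for adjacent vertices $p,q$ of $D$. Then the discrete CMC $1$ surface $f_1$ given by $F$ through the light cone description $$f_{1,p}=r\begin{pmatrix} -b\bar a & a\bar a\\ b\bar b& -a\bar b\end{pmatrix}\in\mathbb{H}^3,\qquad \begin{pmatrix}a\\ b\end{pmatrix}=\begin{pmatrix}0&1\\ j&0\end{pmatrix}F_p\begin{pmatrix} i\\ j\end{pmatrix},$$ where $r$ is the real scalar that places $f_{1,p}$ in the light cone model of $\mathbb{H}^3$, is equal to the surface given by $$\frac{1}{\det F}\,F\,\overline{F}^T$$ (in the Hermitian matrix model of $\mathbb{H}^3$), up to a rigid motion of $\mathbb{H}^3$.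
   Context: Domain and discrete holomorphic functions: $D$ is the square integer lattice $\mathbb{Z}^2$ or a subdomain of it. A map $g:D\to\mathbb{C}$, with $g_q-g_p\neq 0$ for all adjacent $p,q\in D$, is discrete holomorphic if there is a real-valued function $\alpha$ on the (unoriented) edges of $D$, called a cross ratio factorizing function for $g$, such that on each unit square $$\frac{(g_{m+1,n}-g_{m,n})(g_{m,n+1}-g_{m+1,n+1})}{(g_{m+1,n+1}-g_{m+1,n})(g_{m,n}-g_{m,n+1})}=\frac{\alpha_{(m,n)(m+1,n)}}{\alpha_{(m,n)(m,n+1)}}<0,$$ with $\alpha_{(m,n)(m+1,n)}=\alpha_{(m,n+1)(m+1,n+1)}$ and $\alpha_{(m,n)(m,n+1)}=\alpha_{(m+1,n)(m+1,n+1)}$. $F_p$ is a $2\times2$ complex matrix for each $p\in D$. The solution $F$ is defined only up to scalar factors, since applying the equation from $p$ to $q$ and then from $q$ to $p$ multiplies $F_p$ by $1-\lambda\alpha_{pq}$. Hermitian matrix model: Minkowski space $\mathbb{R}^{3,1}$ (metric $-dx_0^2+dx_1^2+dx_2^2+dx_3^2$) is identified with the Hermitian matrices $\begin{pmatrix} x_0+x_3 & x_1+ix_2\\ x_1-ix_2& x_0-x_3\end{pmatrix}$, and $\mathbb{H}^3$ is the set of such $X$ with $\mathrm{tr}(X)>0$ and $\det X=1$. In $\overline{F}^T$ the bar is complex conjugation and $T$ is transposition. Light cone model: let $1,i,j,k$ be the usual basis of the quaternions, with $\mathbb{C}=\mathbb{R}+\mathbb{R}i$ regarded as a subset of the quaternions;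 the bars on $a$ and $b$ denote quaternionic conjugation. $\mathbb{R}^{4,1}$ is the space of matrices $X=\begin{pmatrix} v & x_4+x_0\\ -x_4+x_0 & -v\end{pmatrix}$ with $v=x_1i+x_2j+x_3k$ and $x_0,\dots,x_4\in\mathbb{R}$, with metric given by $\langle X,X\rangle I=-X^2$. Then $\mathbb{H}^3$ is the set of $X\in\mathbb{R}^{4,1}$ with $X^2=0$ and $X\begin{pmatrix}-i&0\\0&i\end{pmatrix}+\begin{pmatrix}-i&0\\0&i\end{pmatrix}X=2I$, with the metric induced from $\mathbb{R}^{4,1}$. Explicitly, $r=2(b\bar a i+ib\bar a)^{-1}=-2(a\bar b i+ia\bar b)^{-1}\in\mathbb{R}$.
   Formalization: That (1/det F) F F̄ᵀ lies in the Hermitian model of H³ is claimed only where det F > 0 (for det F < 0 its trace is negative); det F ≠ 0 is assumed; equality up to one rigid motion, extended linearly to both sheets, is proved for either sign. *)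

theory Defs
  imports "HOL-Analysis.Analysis"
begin

datatype quat = Quat (qRe: real) (qI: real) (qJ: real) (qK: real)

lemma quat_eq_iff: "x = y \<longleftrightarrow> qRe x = qRe y \<and> qI x = qI y \<and> qJ x = qJ y \<and> qK x = qK y"
  by (cases x; cases y) auto

instantiation quat :: real_algebra_1
begin

definition "0 = Quat 0 0 0 0"
definition "1 = Quat 1 0 0 0"
definition "x + y = Quat (qRe x + qRe y) (qI x + qI y) (qJ x + qJ y) (qK x + qK y)"
definition "x - y = Quat (qRe x - qRe y) (qI x - qI y) (qJ x - qJ y) (qK x - qK y)"
definition "- x = Quat (- qRe x) (- qI x) (- qJ x) (- qK x)"
definition "c *\<^sub>R x = Quat (c * qRe x) (c * qI x) (c * qJ x) (c * qK x)"
definition "x * y = Quat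
  (qRe x * qRe y - qI x * qI y - qJ x * qJ y - qK x * qK y)
  (qRe x * qI y + qI x * qRe y + qJ x * qK y - qK x * qJ y)
  (qRe x * qJ y - qI x * qK y + qJ x * qRe y + qK x * qI y)
  (qRe x * qK y + qI x * qJ y - qJ x * qI y + qK x * qRe y)"

instance
  by standard
    (simp_all add: quat_eq_iff zero_quat_def one_quat_def plus_quat_def minus_quat_def
      uminus_quat_def scaleR_quat_def times_quat_def algebra_simps)

end

lemmas quat_defs = zero_quat_def one_quat_def plus_quat_def minus_quat_def
  uminus_quat_def scaleR_quat_def times_quat_def

definition qi :: quat where "qi = Quat 0 1 0 0"
definition qj :: quat where "qj = Quat 0 0 1 0"
definition qk :: quat where "qk = Quat 0 0 0 1"

lemma quat_units:
  "qi * qi = -1" "qj * qj = -1" "qk * qk = -1"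
  "qi * qj = qk" "qj * qk = qi" "qk * qi = qj"
  "qj * qi = - qk" "qk * qj = - qi" "qi * qk = - qj"
  by (simp_all add: quat_eq_iff quat_defs qi_def qj_def qk_def)

definition qcnj :: "quat \<Rightarrow> quat" where
  "qcnj x = Quat (qRe x) (- qI x) (- qJ x) (- qK x)"

definition quat_of_complex :: "complex \<Rightarrow> quat" where
  "quat_of_complex z = Quat (Re z) (Im z) 0 0"

definition mat22 :: "'a \<Rightarrow> 'a \<Rightarrow> 'a \<Rightarrow> 'a \<Rightarrow> 'a::zero^2^2" where
  "mat22 a b c d = vector [vector [a, b], vector [c, d]]"

lemma mat22_nth [simp]:
  "mat22 a b c d $ 1 $ 1 = a" "mat22 a b c d $ 1 $ 2 = b"
  "mat22 a b c d $ 2 $ 1 = c" "mat22 a b c d $ 2 $ 2 = d"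
  by (simp_all add: mat22_def)


subsection \<open>Discrete holomorphic functions\<close>

definition adjacent :: "int \<times> int \<Rightarrow> int \<times> int \<Rightarrow> bool" where
  "adjacent p q \<longleftrightarrow> \<bar>fst p - fst q\<bar> + \<bar>snd p - snd q\<bar> = 1"

text \<open>An unoriented edge is the set of its two end points, so that
  \<open>\<alpha> {p, q} = \<alpha> {q, p}\<close>.  Unit squares are those with all four vertices in \<open>D\<close>.\<close>

definition cross_ratio_factorizing ::
  "(int \<times> int) set \<Rightarrow> (int \<times> int \<Rightarrow> complex) \<Rightarrow> ((int \<times> int) set \<Rightarrow> real) \<Rightarrow> bool" where
  "cross_ratio_factorizing D g \<alpha> \<longleftrightarrow>
    (\<forall>m n. {(m, n), (m + 1, n), (m, n + 1), (m + 1, n + 1)} \<subseteq> D \<longrightarrow>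
       ((g (m + 1, n) - g (m, n)) * (g (m, n + 1) - g (m + 1, n + 1))) /
       ((g (m + 1, n + 1) - g (m + 1, n)) * (g (m, n) - g (m, n + 1)))
         = complex_of_real (\<alpha> {(m, n), (m + 1, n)} / \<alpha> {(m, n), (m, n + 1)}) \<and>
       \<alpha> {(m, n), (m + 1, n)} / \<alpha> {(m, n), (m, n + 1)} < 0 \<and>
       \<alpha> {(m, n), (m + 1, n)} = \<alpha> {(m, n + 1), (m + 1, n + 1)} \<and>
       \<alpha> {(m, n), (m, n + 1)} = \<alpha> {(m + 1, n), (m + 1, n + 1)})"

definition discrete_holomorphic ::
  "(int \<times> int) set \<Rightarrow> (int \<times> int \<Rightarrow> complex) \<Rightarrow> bool" where
  "discrete_holomorphic D g \<longleftrightarrow>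
    (\<forall>p\<in>D. \<forall>q\<in>D. adjacent p q \<longrightarrow> g q - g p \<noteq> 0) \<and>
    (\<exists>\<alpha>. cross_ratio_factorizing D g \<alpha>)"


subsection \<open>The discrete Bryant equation\<close>

text \<open>Solutions are defined only up to scalar factors: imposed verbatim on both orientations
  of an edge, the equation would give \<open>F p = (1 - lam \<alpha> {p, q}) F p\<close>.  Hence for every ordered pair
  of adjacent vertices the equation is required of \<open>F p\<close> and some nonzero multiple of \<open>F q\<close>.\<close>

definition bryant_solution ::
  "(int \<times> int) set \<Rightarrow> (int \<times> int \<Rightarrow> complex) \<Rightarrow> ((int \<times> int) set \<Rightarrow> real) \<Rightarrow> real
     \<Rightarrow> (int \<times> int \<Rightarrow> complex^2^2) \<Rightarrow> bool" where
  "bryant_solution D g \<alpha> lam F \<longleftrightarrow>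
    (\<forall>p\<in>D. \<forall>q\<in>D. adjacent p q \<longrightarrow>
      (\<exists>c. c \<noteq> 0 \<and>
        map_matrix ((*) c) (F q) - F p =
          map_matrix ((*) (complex_of_real (lam * \<alpha> {p, q}) / (g q - g p)))
            (F p ** mat22 (g p) (- g p * g q) 1 (- g q))))"


subsection \<open>Hermitian matrix model\<close>

text \<open>The coordinates of a point of Minkowski space are \<open>x $ 0, \<dots>, x $ 3\<close>; the index \<open>0 :: 4\<close>
  is the same as \<open>4 :: 4\<close>.\<close>

definition mink :: "real^4 \<Rightarrow> real^4 \<Rightarrow> real" where
  "mink x y = - x $ 0 * y $ 0 + x $ 1 * y $ 1 + x $ 2 * y $ 2 + x $ 3 * y $ 3"

definition herm :: "real^4 \<Rightarrow> complex^2^2" where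
  "herm x = mat22 (of_real (x $ 0 + x $ 3)) (Complex (x $ 1) (x $ 2))
                  (Complex (x $ 1) (- x $ 2)) (of_real (x $ 0 - x $ 3))"

definition H3_herm :: "(complex^2^2) set" where
  "H3_herm = {X \<in> range herm. 0 < Re (trace X) \<and> det X = 1}"

definition surface_herm :: "complex^2^2 \<Rightarrow> complex^2^2" where
  "surface_herm A = map_matrix ((*) (1 / det A)) (A ** transpose (map_matrix cnj A))"


subsection \<open>Light cone model\<close>

definition lc_matrix :: "real \<Rightarrow> real \<Rightarrow> real \<Rightarrow> real \<Rightarrow> real \<Rightarrow> quat^2^2" where
  "lc_matrix x0 x1 x2 x3 x4 =
    (let v = x1 *\<^sub>R qi + x2 *\<^sub>R qj + x3 *\<^sub>R qk
     in mat22 v (of_real (x4 + x0)) (of_real (- x4 + x0)) (- v))"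

definition R41 :: "(quat^2^2) set" where
  "R41 = {lc_matrix x0 x1 x2 x3 x4 |x0 x1 x2 x3 x4. True}"

text \<open>These two equations do not fix the sign of \<open>x\<^sub>0\<close>, so the set consists of two copies of
  hyperbolic space.\<close>

definition H3_lc :: "(quat^2^2) set" where
  "H3_lc = {X \<in> R41. X ** X = 0 \<and>
     X ** mat22 (- qi) 0 0 qi + mat22 (- qi) 0 0 qi ** X = mat 2}"

definition spinor :: "complex^2^2 \<Rightarrow> quat^2" where
  "spinor A = (mat22 0 1 qj 0 ** map_matrix quat_of_complex A) *v vector [qi, qj]"

definition lc_dir :: "quat \<Rightarrow> quat \<Rightarrow> quat^2^2" where
  "lc_dir a b = mat22 (- b * qcnj a) (a * qcnj a) (b * qcnj b) (- a * qcnj b)"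

definition surface_lc :: "complex^2^2 \<Rightarrow> quat^2^2" where
  "surface_lc A =
    (let M = lc_dir (spinor A $ 1) (spinor A $ 2)
     in (THE r. r *\<^sub>R M \<in> H3_lc) *\<^sub>R M)"


subsection \<open>Comparing the two models\<close>

text \<open>On the light cone model \<open>x\<^sub>1 = 1\<close>; the remaining coordinates \<open>x\<^sub>0, x\<^sub>2, x\<^sub>3, x\<^sub>4\<close> are used, in
  this order, as coordinates on Minkowski space.  The lemmas below show that this identifies
  the two models isometrically, where the metric on the light cone side is given by
  \<open>\<langle>X, X\<rangle> I = - X ** X\<close>.\<close>

definition lc_point :: "real^4 \<Rightarrow> quat^2^2" where
  "lc_point x = lc_matrix (x $ 0) 1 (x $ 1) (x $ 2) (x $ 3)"

lemma lc_point_metric: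
  "- ((lc_point x - lc_point y) ** (lc_point x - lc_point y)) = mat (of_real (mink (x - y) (x - y)))"
  by (simp add: vec_eq_iff forall_2 matrix_matrix_mult_def sum_2 mat_def lc_point_def
      lc_matrix_def Let_def mink_def quat_eq_iff quat_defs of_real_def qi_def qj_def qk_def
      algebra_simps)

lemma H3_lc_eq: "H3_lc = lc_point ` {x. mink x x = - 1}"
proof (rule set_eqI, rule iffI)
  have two: "(2::quat) = Quat 2 0 0 0"
    using of_real_numeral[where 'a = quat, of "num.Bit0 num.One"]
    by (simp add: of_real_def quat_defs)
  note simps = vec_eq_iff forall_2 matrix_matrix_mult_def sum_2 mat_def
    lc_point_def lc_matrix_def Let_def mink_def quat_eq_iff quat_defs of_real_def
    qi_def qj_def qk_def two
  {
    fix X assume X: "X \<in> H3_lc"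
    then obtain x0 x1 x2 x3 x4 where eq: "X = lc_matrix x0 x1 x2 x3 x4"
      by (auto simp: H3_lc_def R41_def)
    define x :: "real^4" where
      "x = (\<chi> i. if i = 0 then x0 else if i = 1 then x2 else if i = 2 then x3 else x4)"
    have "x1 = 1" "x0 * x0 = 1 + x2 * x2 + x3 * x3 + x4 * x4"
      using X by (auto simp: H3_lc_def eq simps algebra_simps)
    then have "X = lc_point x" "mink x x = - 1"
      by (simp_all add: eq lc_point_def x_def mink_def)
    then show "X \<in> lc_point ` {x. mink x x = - 1}" by blast
  next
    fix X assume "X \<in> lc_point ` {x. mink x x = - 1}"
    then obtain x where x: "X = lc_point x" "mink x x = - 1" by blast
    have "X \<in> R41"
      unfolding x(1) lc_point_def R41_def by blast
    then show "X \<in> H3_lc"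
      using x(2) by (simp add: H3_lc_def x(1)) (simp add: simps algebra_simps)
  }
qed

lemma H3_herm_eq: "H3_herm = herm ` {x. mink x x = - 1 \<and> 0 < x $ 0}"
proof -
  have "det (herm x) = of_real (- mink x x)" for x
    by (simp add: herm_def det_2 mink_def complex_eq_iff algebra_simps)
  moreover have "trace (herm x) = of_real (2 * x $ 0)" for x
    by (simp add: herm_def trace_def sum_2)
  ultimately show ?thesis
    by (auto simp: H3_herm_def complex_eq_iff)
qed

text \<open>Rigid motions of hyperbolic space: orientation preserving isometries of Minkowski space
  that map hyperbolic space onto itself.  Being linear, they also act on the other sheet
  \<open>mink x x = - 1\<close>, \<open>x $ 0 < 0\<close>.\<close>

definition rigid_motion :: "(real^4 \<Rightarrow> real^4) \<Rightarrow> bool" where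
  "rigid_motion \<phi> \<longleftrightarrow>
    linear \<phi> \<and> (\<forall>x y. mink (\<phi> x) (\<phi> y) = mink x y) \<and>
    \<phi> ` {x. herm x \<in> H3_herm} = {x. herm x \<in> H3_herm} \<and>
    det (matrix \<phi>) > 0"

end

theory Submission
  imports Defs
begin

text \<open>
  The comparison is made vertex by vertex.  Let \<open>d\<close> be the determinant of \<open>A = F p\<close>, let
  \<open>n\<^sub>1\<close>, \<open>n\<^sub>2\<close> be the squared norms of the rows of \<open>A\<close> and \<open>u\<close> the Hermitian product of its
  second row with its first.  Multiplying out the quaternions gives \<open>a \<cdot> qcnj a = n\<^sub>2\<close>,
  \<open>b \<cdot> qcnj b = n\<^sub>1\<close> and \<open>a \<cdot> qcnj b = d i - u j\<close>.  Hence \<open>r = 1 / d\<close>, and the light cone point has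
  the coordinates \<open>((n\<^sub>1 + n\<^sub>2) / 2, - Re u, - Im u, (n\<^sub>2 - n\<^sub>1) / 2) / d\<close>, whereas \<open>A A\<^sup>* / d\<close> has
  \<open>((n\<^sub>1 + n\<^sub>2) / 2, Re u, - Im u, (n\<^sub>1 - n\<^sub>2) / 2) / d\<close>.  The half turn that negates the first and
  third spatial coordinates takes one to the other.
\<close>

definition half_turn :: "real^4 \<Rightarrow> real^4" where
  "half_turn x = (\<chi> i. if i = 1 \<or> i = 3 then - x $ i else x $ i)"

lemma half_turn_nth [simp]:
  "half_turn x $ 0 = x $ 0" "half_turn x $ 1 = - x $ 1"
  "half_turn x $ 2 = x $ 2" "half_turn x $ 3 = - x $ 3"
  by (simp_all add: half_turn_def)

lemma half_turn_half_turn [simp]: "half_turn (half_turn x) = x"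
  by (simp add: half_turn_def vec_eq_iff)

lemma linear_half_turn: "linear half_turn"
  by (rule linearI) (simp_all add: half_turn_def vec_eq_iff)

lemma mink_half_turn: "mink (half_turn x) (half_turn y) = mink x y"
  by (simp add: mink_def)

text \<open>An even number of signs change, so the orientation is kept, as
  \<open>rigid_motion\<close> demands.\<close>

lemma det_matrix_half_turn: "det (matrix half_turn) = 1"
proof -
  have "matrix half_turn $ i $ j = (if i = j then if i = 1 \<or> i = 3 then - 1 else 1 else 0)" for i j
    by (simp add: matrix_def half_turn_def axis_def)
  then have "det (matrix half_turn) = (\<Prod>i::4\<in>UNIV. if i = 1 \<or> i = 3 then - 1 else 1)"
    by (subst det_diagonal) simp_all
  also have "\<dots> = 1"
    unfolding UNIV_4 by simp
  finally show ?thesis .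
qed

text \<open>Membership in the image from \<open>H3_herm_eq\<close> passes to coordinates because
  \<open>herm\<close> is injective: the diagonal determines x_0 and x_3, the upper right entry x_1
  and x_2.\<close>

lemma herm_in_H3_herm_iff: "herm x \<in> H3_herm \<longleftrightarrow> mink x x = - 1 \<and> 0 < x $ 0"
proof -
  have "inj herm"
  proof (rule injI)
    fix x y assume eq: "herm x = herm y"
    have "x $ 0 + x $ 3 = y $ 0 + y $ 3" "x $ 0 - x $ 3 = y $ 0 - y $ 3"
      "x $ 1 = y $ 1" "x $ 2 = y $ 2"
      using arg_cong[OF eq, of "\<lambda>X. Re (X $ 1 $ 1)"] arg_cong[OF eq, of "\<lambda>X. Re (X $ 2 $ 2)"]
        arg_cong[OF eq, of "\<lambda>X. Re (X $ 1 $ 2)"] arg_cong[OF eq, of "\<lambda>X. Im (X $ 1 $ 2)"]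
      by (simp_all add: herm_def)
    \<comment> \<open>\<open>forall_4\<close> runs over the indices 1 to 4, while
      \<open>herm\<close> reads the time coordinate at index 0.\<close>
    moreover have "(4 :: 4) = 0" by simp
    ultimately show "x = y"
      unfolding vec_eq_iff forall_4 \<open>4 = 0\<close> by linarith
  qed
  then show ?thesis
    by (auto simp: H3_herm_eq inj_image_mem_iff dest: injD)
qed

lemma rigid_motion_half_turn: "rigid_motion half_turn"
proof -
  have "x \<in> half_turn ` {x. herm x \<in> H3_herm}" if "herm x \<in> H3_herm" for x
    using that
    by (intro image_eqI[of x half_turn "half_turn x"])
      (simp_all add: herm_in_H3_herm_iff mink_half_turn)
  then have "half_turn ` {x. herm x \<in> H3_herm} = {x. herm x \<in> H3_herm}"
    by (auto simp: herm_in_H3_herm_iff mink_half_turn)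
  then show ?thesis
    by (simp add: rigid_motion_def linear_half_turn mink_half_turn det_matrix_half_turn)
qed

text \<open>The coordinates of \<open>A\<close> times its adjoint, divided by \<open>d\<close>. Here
  \<open>w\<close> is the upper right entry of that product, the conjugate of u above, and
  \<open>d\<close> stands for the determinant as a real number.\<close>

definition herm_coords :: "complex^2^2 \<Rightarrow> real \<Rightarrow> real^4" where
  "herm_coords A d =
    (let n1 = (cmod (A $ 1 $ 1))\<^sup>2 + (cmod (A $ 1 $ 2))\<^sup>2;
         n2 = (cmod (A $ 2 $ 1))\<^sup>2 + (cmod (A $ 2 $ 2))\<^sup>2;
         w = A $ 1 $ 1 * cnj (A $ 2 $ 1) + A $ 1 $ 2 * cnj (A $ 2 $ 2)
     in \<chi> i. (if i = 0 then (n1 + n2) / 2 else if i = 1 then Re w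
              else if i = 2 then Im w else (n1 - n2) / 2) / d)"

lemma det_map_matrix_times:
  "det (map_matrix ((*) c) B) = c\<^sup>2 * det B" for B :: "'a::comm_ring_1^2^2"
  by (simp add: det_2 map_matrix_def power2_eq_square algebra_simps)

context
  fixes A :: "complex^2^2" and d :: real
  assumes det: "det A = of_real d" and nz: "d \<noteq> 0"
begin

lemma surface_herm_eq: "surface_herm A = herm (herm_coords A d)"
proof -
  let ?n = "\<lambda>i. (cmod (A $ i $ 1))\<^sup>2 + (cmod (A $ i $ 2))\<^sup>2"
  let ?w = "A $ 1 $ 1 * cnj (A $ 2 $ 1) + A $ 1 $ 2 * cnj (A $ 2 $ 2)"
  have "surface_herm A = mat22 (of_real (?n 1) / of_real d) (?w / of_real d)
      (cnj ?w / of_real d) (of_real (?n 2) / of_real d)"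
    by (simp add: surface_herm_def det vec_eq_iff forall_2 matrix_matrix_mult_def sum_2
        transpose_def map_matrix_def complex_norm_square mult.commute del: of_real_power)
  also have "\<dots> = mat22 (of_real (?n 1 / d)) (Complex (Re ?w / d) (Im ?w / d))
      (Complex (Re ?w / d) (- (Im ?w / d))) (of_real (?n 2 / d))"
    by (simp add: complex_eq_iff Re_divide_of_real Im_divide_of_real vec_eq_iff forall_2
        minus_divide_left)
  also have "\<dots> = herm (herm_coords A d)"
  proof -
    have "herm_coords A d $ 0 + herm_coords A d $ 3 = ?n 1 / d"
      "herm_coords A d $ 0 - herm_coords A d $ 3 = ?n 2 / d"
      "herm_coords A d $ 1 = Re ?w / d" "herm_coords A d $ 2 = Im ?w / d"
      using nz by (simp_all add: herm_coords_def Let_def field_simps)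
    then show ?thesis
      by (simp only: herm_def)
  qed
  finally show ?thesis .
qed

text \<open>Minus the Minkowski norm is the determinant of the Hermitian matrix, and for real
  \<open>d\<close> this is d * d / d^2 = 1.\<close>

lemma mink_herm_coords: "mink (herm_coords A d) (herm_coords A d) = - 1"
proof -
  have "of_real (- mink (herm_coords A d) (herm_coords A d)) = det (herm (herm_coords A d))"
    by (simp add: herm_def det_2 mink_def complex_eq_iff algebra_simps)
  also have "\<dots> = det (surface_herm A)"
    by (simp add: surface_herm_eq)
  also have "\<dots> = (1 / det A)\<^sup>2 * det (A ** transpose (map_matrix cnj A))"
    by (simp only: surface_herm_def det_map_matrix_times)
  also have "det (A ** transpose (map_matrix cnj A)) = det A * cnj (det A)"
    unfolding det_mul det_transpose by (simp add: det_2 map_matrix_def)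
  also have "(1 / det A)\<^sup>2 * (det A * cnj (det A)) = 1"
    using nz by (simp add: det power2_eq_square)
  finally show ?thesis
    by (simp add: complex_eq_iff)
qed

lemma lc_dir_spinor:
  "lc_dir (spinor A $ 1) (spinor A $ 2) = d *\<^sub>R lc_point (half_turn (herm_coords A d))"
proof -
  obtain p1 p2 q1 q2 r1 r2 s1 s2 where A:
    "A $ 1 $ 1 = Complex p1 p2" "A $ 1 $ 2 = Complex q1 q2"
    "A $ 2 $ 1 = Complex r1 r2" "A $ 2 $ 2 = Complex s1 s2"
    by (metis complex.exhaust)
  \<comment> \<open>The real part of a * \<open>qcnj\<close> b is minus the imaginary part of the
    determinant, so it vanishes; the i-part is the real part, \<open>d\<close>.\<close>
  have d: "p1 * s1 - p2 * s2 - (q1 * r1 - q2 * r2) = d" "p1 * s2 + p2 * s1 - (q1 * r2 + q2 * r1) = 0"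
    using det by (simp_all add: det_2 A complex_eq_iff)
  have a: "spinor A $ 1 = Quat (- r2) r1 s1 s2"
    and b: "spinor A $ 2 = Quat (- q1) q2 (- p2) (- p1)"
    by (simp_all add: spinor_def matrix_vector_mult_def matrix_matrix_mult_def sum_2
        map_matrix_def A quat_of_complex_def quat_defs qi_def qj_def)
  let ?x = "herm_coords A d"
  \<comment> \<open>Scaling by \<open>d\<close> clears the denominator and leaves polynomial
    identities in the eight real parameters.\<close>
  have x: "d * ?x $ 0 = (p1\<^sup>2 + p2\<^sup>2 + q1\<^sup>2 + q2\<^sup>2 + (r1\<^sup>2 + r2\<^sup>2 + s1\<^sup>2 + s2\<^sup>2)) / 2"
    "d * ?x $ 1 = p1 * r1 + p2 * r2 + q1 * s1 + q2 * s2"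
    "d * ?x $ 2 = p2 * r1 - p1 * r2 + q2 * s1 - q1 * s2"
    "d * ?x $ 3 = (p1\<^sup>2 + p2\<^sup>2 + q1\<^sup>2 + q2\<^sup>2 - (r1\<^sup>2 + r2\<^sup>2 + s1\<^sup>2 + s2\<^sup>2)) / 2"
    using nz by (simp_all add: herm_coords_def Let_def A cmod_power2)
  have "d *\<^sub>R lc_point (half_turn ?x) =
    mat22 (Quat 0 d (- (d * ?x $ 1)) (d * ?x $ 2)) (Quat (d * ?x $ 0 - d * ?x $ 3) 0 0 0)
      (Quat (d * ?x $ 0 + d * ?x $ 3) 0 0 0) (Quat 0 (- d) (d * ?x $ 1) (- (d * ?x $ 2)))"
    by (simp add: vec_eq_iff forall_2 lc_point_def lc_matrix_def Let_def quat_eq_iff quat_defs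
        of_real_def qi_def qj_def qk_def algebra_simps)
  also have "\<dots> = lc_dir (spinor A $ 1) (spinor A $ 2)"
    using d unfolding x a b
    by (simp add: lc_dir_def vec_eq_iff forall_2 quat_eq_iff times_quat_def uminus_quat_def
        qcnj_def power2_eq_square field_simps)
  finally show ?thesis
    by simp
qed

lemma surface_lc_eq: "surface_lc A = lc_point (half_turn (herm_coords A d))"
  and surface_lc_in_H3_lc: "surface_lc A \<in> H3_lc"
proof -
  let ?X = "lc_point (half_turn (herm_coords A d))"
  have X: "?X \<in> H3_lc"
    by (simp add: H3_lc_eq mink_half_turn mink_herm_coords)
  \<comment> \<open>This normalization gives the uniqueness that \<open>THE\<close> needs: it forces
    r * d = 1. The sign of \<open>d\<close> is free, since a negative \<open>d\<close> leads to the
    other sheet of \<open>H3_lc\<close>.\<close>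
  have qI: "qI (lc_point x $ 1 $ 1) = 1" for x
    by (simp add: lc_point_def lc_matrix_def Let_def quat_defs qi_def qj_def qk_def)
  have "r = 1 / d" if "r *\<^sub>R d *\<^sub>R ?X \<in> H3_lc" for r
  proof -
    obtain x where "r *\<^sub>R d *\<^sub>R ?X = lc_point x"
      using \<open>r *\<^sub>R d *\<^sub>R ?X \<in> H3_lc\<close> unfolding H3_lc_eq by (elim imageE)
    then have "qI ((r *\<^sub>R d *\<^sub>R ?X) $ 1 $ 1) = 1"
      by (simp only: qI)
    moreover have "qI ((r *\<^sub>R d *\<^sub>R ?X) $ 1 $ 1) = r * (d * qI (?X $ 1 $ 1))"
      by (simp add: scaleR_quat_def)
    ultimately show ?thesis
      using nz qI by (simp add: field_simps)
  qed
  then have "(THE r. r *\<^sub>R d *\<^sub>R ?X \<in> H3_lc) = 1 / d"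
    using X nz by (intro the_equality) auto
  then show "surface_lc A = ?X"
    using nz by (simp add: surface_lc_def lc_dir_spinor)
  with X show "surface_lc A \<in> H3_lc"
    by simp
qed

lemma surface_herm_in_H3_herm: "surface_herm A \<in> H3_herm" if "0 < d"
proof -
  have "herm_coords A d $ 0 \<ge> 0"
    using that by (simp add: herm_coords_def Let_def)
  \<comment> \<open>If x_0 vanished, \<open>mink\<close> would be a sum of squares and could not
    equal -1.\<close>
  moreover have "herm_coords A d $ 0 \<noteq> 0"
    using mink_herm_coords
    by (smt (verit) mink_def zero_le_square mult_eq_0_iff)
  ultimately show ?thesis
    by (simp add: surface_herm_eq herm_in_H3_herm_iff mink_herm_coords)
qed

end

theorem theorem4p2:
  fixes D :: "(int \<times> int) set"
    and g :: "int \<times> int \<Rightarrow> complex"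
    and \<alpha> :: "(int \<times> int) set \<Rightarrow> real"
    and lam :: real
    and F :: "int \<times> int \<Rightarrow> complex^2^2"
  assumes "discrete_holomorphic D g"
    and "cross_ratio_factorizing D g \<alpha>"
    and "lam \<noteq> 0"
    and "bryant_solution D g \<alpha> lam F"
    and "\<And>p. p \<in> D \<Longrightarrow> det (F p) \<in> \<real>"
    and "\<And>p. p \<in> D \<Longrightarrow> det (F p) \<noteq> 0"
  shows "\<exists>\<phi>. rigid_motion \<phi> \<and>
    (\<forall>p\<in>D. surface_lc (F p) \<in> H3_lc \<and>
      (\<exists>x. surface_lc (F p) = lc_point x \<and> surface_herm (F p) = herm (\<phi> x)) \<and>
      (0 < Re (det (F p)) \<longrightarrow> surface_herm (F p) \<in> H3_herm))"
proof (intro exI[of _ half_turn] conjI ballI impI rigid_motion_half_turn)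
  fix p assume p: "p \<in> D"
  define d where "d = Re (det (F p))"
  have det: "det (F p) = of_real d" and nz: "d \<noteq> 0"
    using assms(5,6)[OF p] by (auto simp: d_def complex_is_Real_iff complex_eq_iff)
  show "surface_lc (F p) \<in> H3_lc"
    by (rule surface_lc_in_H3_lc[OF det nz])
  \<comment> \<open>As \<open>half_turn\<close> is an involution, it carries the light cone
    coordinates back to \<open>herm_coords\<close>, by one motion for all vertices.\<close>
  show "\<exists>x. surface_lc (F p) = lc_point x \<and> surface_herm (F p) = herm (half_turn x)"
    using surface_lc_eq[OF det nz] surface_herm_eq[OF det nz]
    by (intro exI[of _ "half_turn (herm_coords (F p) d)"]) simp
  assume "0 < Re (det (F p))"
  then show "surface_herm (F p) \<in> H3_herm"
    by (intro surface_herm_in_H3_herm[OF det nz]) (simp add: d_def)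
qed

end
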